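(* Let $\mathbf{A}_\bullet$ be a representation of a quiver $Q$ valued in finite-dimensional real vector spaces, with $\mathrm{Tot}(\mathbf{A}_\bullet)\simeq\mathbb{R}^n$ and $d=\dim\Gamma(Q;\mathbf{A}_\bullet)$, and let $F$ be a full-rank $n\times d$ real matrix whose image is $\Gamma(Q;\mathbf{A}_\bullet)\subset\mathbb{R}^n$. Let $S$ be the sample covariance of a sufficiently generic mean-centred subset $D=\{y_1,\dots,y_m\}\subset\mathbb{R}^n$ of cardinality $m\ge n$. Then for each $1\le r\le d$, the $r$-th principal component $\mathbf{PC}_r(D;\mathbf{A}_\bullet)$ of $D$ along $\mathbf{A}_\bullet$ is spanned by $Fu_r$, where $u_r$ is the generalised eigenvector of the matrix pencil $F^{\mathsf T}SF-\lambda(F^{\mathsf T}F)$ corresponding to its $r$-th largest generalised eigenvalue.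
   Context: A quiver $Q=(s,t:E\to V)$ consists of finite sets $V$ (vertices), $E$ (edges) and maps $s,t:E\to V$. A representation $\mathbf{A}_\bullet$ assigns a finite-dimensional (here real) vector space $\mathbf{A}_v$ to each $v\in V$ and a linear map $\mathbf{A}_e:\mathbf{A}_{s(e)}\to\mathbf{A}_{t(e)}$ to each $e\in E$. $\mathrm{Tot}(\mathbf{A}_\bullet)=\prod_{v}\mathbf{A}_v$, and $\Gamma(Q;\mathbf{A}_\bullet)\subset\mathrm{Tot}(\mathbf{A}_\bullet)$ is the subspace of sections: those $(\gamma_v)_v$ with $\gamma_{t(e)}=\mathbf{A}_e(\gamma_{s(e)})$ for all $e\in E$. Fixed isomorphisms $\mathbb{R}^{\dim\mathbf{A}_v}\simeq\mathbf{A}_v$ identify $\mathrm{Tot}(\mathbf{A}_\bullet)$ with $\mathbb{R}^n$, $n=\sum_v\dim\mathbf{A}_v$, with its standard inner product. $D=\{y_1,\dots,y_m\}$ is mean-centred if $\frac1m\sum_i y_i=0$; its sample covariance is $S=\frac1m\sum_{i=1}^m y_iy_i^{\mathsf T}$. Principal components along $\mathbf{A}_\bullet$: for $r\le d$ consider maximising $\mathrm{tr}(X^{\mathsf T}SX)$ over $n\times r$ matrices $X=[x_1\cdots x_r]$ with $X^{\mathsf T}X=\mathrm{id}_r$ and $x_1,\dots,x_r\in\Gamma(Q;\mathbf{A}_\bullet)$. An optimal solution is built (generically uniquely up to signs of columns) one column at a time: $x_r$ maximises $x^{\mathsf T}Sx$ over unit vectors $x\in\Gamma(Q;\mathbf{A}_\bullet)$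 orthogonal to $x_1,\dots,x_{r-1}$. The $r$-th principal component $\mathbf{PC}_r(D;\mathbf{A}_\bullet)$ is the line spanned by $x_r$. For square matrices $A,B$ of equal size, the generalised eigenvalues of the pencil $A-\lambda B$ are the solutions $\lambda$ of $\det(A-\lambda B)=0$; a generalised eigenvector for $\lambda$ is a nonzero $x$ with $Ax=\lambda Bx$. "Sufficiently generic" means: for all $(y_1,\dots,y_m)$ in some nonempty Zariski-open subset (depending on $Q,\mathbf{A}_\bullet,m$) of the vector space of mean-centred $m$-tuples in $\mathbb{R}^n$. *)

theory Defs
  imports "HOL-Analysis.Analysis" "Graph_Theory.Digraph"
begin

text \<open>
  A quiver is a finite directed multigraph with loops allowed, i.e. a \<^locale>\<open>fin_digraph\<close>;
  \<^const>\<open>tail\<close> is the source map and \<^const>\<open>head\<close> is the target map. The vector spaces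
  \<open>A v\<close> are finite-dimensional subspaces of an arbitrary real vector space \<open>'a\<close> (of any
  dimension, so every finite family of finite-dimensional spaces occurs up to isomorphism).
  Outside \<open>A (tail Q e)\<close> the function \<open>M e\<close> is unconstrained and irrelevant.
\<close>

locale quiver_rep = fin_digraph Q
  for Q :: "('v, 'e) pre_digraph" +
  fixes A :: "'v \<Rightarrow> 'a::real_vector set"
    and M :: "'e \<Rightarrow> 'a \<Rightarrow> 'a"
  assumes subspace_vertex: "v \<in> verts Q \<Longrightarrow> subspace (A v)"
    and finite_dim_vertex: "v \<in> verts Q \<Longrightarrow> \<exists>B. finite B \<and> span B = A v"
    and edge_into: "\<lbrakk>e \<in> arcs Q; a \<in> A (tail Q e)\<rbrakk> \<Longrightarrow> M e a \<in> A (head Q e)"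
    and edge_add: "\<lbrakk>e \<in> arcs Q; a \<in> A (tail Q e); b \<in> A (tail Q e)\<rbrakk>
                     \<Longrightarrow> M e (a + b) = M e a + M e b"
    and edge_scale: "\<lbrakk>e \<in> arcs Q; a \<in> A (tail Q e)\<rbrakk> \<Longrightarrow> M e (c *\<^sub>R a) = c *\<^sub>R M e a"

text \<open>
  Elements of the product over \<open>verts Q\<close> are represented by functions that vanish off \<open>verts Q\<close>.
\<close>

definition Tot :: "('v, 'e) pre_digraph \<Rightarrow> ('v \<Rightarrow> 'a::real_vector set) \<Rightarrow> ('v \<Rightarrow> 'a) set" where
  "Tot Q A = {\<gamma>. (\<forall>v\<in>verts Q. \<gamma> v \<in> A v) \<and> (\<forall>v. v \<notin> verts Q \<longrightarrow> \<gamma> v = 0)}"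

definition sections ::
  "('v, 'e) pre_digraph \<Rightarrow> ('v \<Rightarrow> 'a::real_vector set) \<Rightarrow> ('e \<Rightarrow> 'a \<Rightarrow> 'a) \<Rightarrow> ('v \<Rightarrow> 'a) set" where
  "sections Q A M = {\<gamma> \<in> Tot Q A. \<forall>e\<in>arcs Q. \<gamma> (head Q e) = M e (\<gamma> (tail Q e))}"

text \<open>
  Fixed isomorphisms of \<open>A v\<close> with standard coordinate spaces amount to a choice of a basis of
  each \<open>A v\<close>. The coordinates of \<open>Tot Q A\<close> are indexed by \<open>'n\<close>: coordinate \<open>i\<close> belongs to the
  vertex \<open>vtx i\<close> and to the basis vector \<open>b i\<close> of \<open>A (vtx i)\<close>. In particular \<open>CARD('n)\<close> is the
  sum of the dimensions of the \<open>A v\<close>.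
\<close>

definition tot_basis ::
  "('v, 'e) pre_digraph \<Rightarrow> ('v \<Rightarrow> 'a::real_vector set) \<Rightarrow> ('n::finite \<Rightarrow> 'v) \<Rightarrow> ('n \<Rightarrow> 'a) \<Rightarrow> bool" where
  "tot_basis Q A vtx b \<longleftrightarrow>
     (\<forall>i. vtx i \<in> verts Q) \<and>
     (\<forall>v\<in>verts Q. inj_on b {i. vtx i = v} \<and>
                  independent (b ` {i. vtx i = v}) \<and> span (b ` {i. vtx i = v}) = A v)"

definition tot_of_vec ::
  "('n::finite \<Rightarrow> 'v) \<Rightarrow> ('n \<Rightarrow> 'a::real_vector) \<Rightarrow> real^'n \<Rightarrow> 'v \<Rightarrow> 'a" where
  "tot_of_vec vtx b x = (\<lambda>v. \<Sum>i | vtx i = v. (x $ i) *\<^sub>R b i)"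

definition section_space ::
  "('v, 'e) pre_digraph \<Rightarrow> ('v \<Rightarrow> 'a::real_vector set) \<Rightarrow> ('e \<Rightarrow> 'a \<Rightarrow> 'a) \<Rightarrow>
   ('n::finite \<Rightarrow> 'v) \<Rightarrow> ('n \<Rightarrow> 'a) \<Rightarrow> (real^'n) set" where
  "section_space Q A M vtx b = {x. tot_of_vec vtx b x \<in> sections Q A M}"

definition mean_centred_tuples :: "(real^'n^'m) set" where
  "mean_centred_tuples = {y. (1 / real CARD('m)) *\<^sub>R (\<Sum>i\<in>UNIV. y $ i) = 0}"

definition sample_covariance :: "(real^'n) set \<Rightarrow> real^'n^'n" where
  "sample_covariance D =
     (1 / real (card D)) *\<^sub>R (\<Sum>y\<in>D. columnvector y ** transpose (columnvector y :: real^1^'n))"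

text \<open>
  \<open>x 1, \<dots>, x r\<close> is a possible outcome of the column-by-column construction; the line \<open>L\<close> is a
  possible value of the \<open>r\<close>-th principal component. Uniqueness is not built in.
\<close>

definition principal_vectors ::
  "(real^'n) set \<Rightarrow> (real^'n) set \<Rightarrow> nat \<Rightarrow> (nat \<Rightarrow> real^'n) \<Rightarrow> bool" where
  "principal_vectors \<Gamma> D r x \<longleftrightarrow>
     (\<forall>k\<in>{1..r}. is_arg_max (\<lambda>z. z \<bullet> (sample_covariance D *v z))
        (\<lambda>z. z \<in> \<Gamma> \<and> norm z = 1 \<and> (\<forall>j\<in>{1..<k}. orthogonal z (x j))) (x k))"

definition is_principal_component ::
  "(real^'n) set \<Rightarrow> (real^'n) set \<Rightarrow> nat \<Rightarrow> (real^'n) set \<Rightarrow> bool" where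
  "is_principal_component \<Gamma> D r L \<longleftrightarrow> (\<exists>x. principal_vectors \<Gamma> D r x \<and> L = span {x r})"

definition gen_eigenvalues :: "real^'d^'d \<Rightarrow> real^'d^'d \<Rightarrow> real set" where
  "gen_eigenvalues A B = {l. det (A - l *\<^sub>R B) = 0}"

definition gen_eigenvector :: "real^'d^'d \<Rightarrow> real^'d^'d \<Rightarrow> real \<Rightarrow> real^'d \<Rightarrow> bool" where
  "gen_eigenvector A B l x \<longleftrightarrow> x \<noteq> 0 \<and> A *v x = l *\<^sub>R (B *v x)"

text \<open>Counted from 1, without multiplicities.\<close>

definition is_nth_largest :: "nat \<Rightarrow> real set \<Rightarrow> real \<Rightarrow> bool" where
  "is_nth_largest r E l \<longleftrightarrow> l \<in> E \<and> finite {k\<in>E. l < k} \<and> card {k\<in>E. l < k} + 1 = r"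

text \<open>
  Polynomial functions on a subspace \<open>W\<close> are the restrictions of polynomial functions on the
  ambient space, so this is the Zariski topology of \<open>W\<close>.
\<close>

definition zariski_open_in :: "'a::euclidean_space set \<Rightarrow> 'a set \<Rightarrow> bool" where
  "zariski_open_in W U \<longleftrightarrow>
     (\<exists>P. (\<forall>p\<in>P. real_polynomial_function p) \<and> U = {y \<in> W. \<exists>p\<in>P. p y \<noteq> 0})"

end

theory Submission
  imports Defs
begin

text \<open>
  Pulling the form of \<open>S\<close> and the inner product back along \<open>F\<close> turns the pencil into a
  statement about \<open>\<Gamma>\<close>, the space of sections: \<open>u\<close> is a generalised eigenvector for \<open>l\<close> iff
  \<open>x = F u\<close> satisfies \<open>z \<bullet> S x = l (z \<bullet> x)\<close> for all \<open>z \<in> \<Gamma>\<close>. Such an \<open>x\<close> is called a Ritz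
  vector here; it is an eigenvector of the compression of \<open>S\<close> to \<open>\<Gamma>\<close>
  (\<open>gen_eigenvector_iff_ritz_vector\<close>). What is left is the usual
  correspondence between iterated maximisation of the variance and the ordered spectrum of a
  self-adjoint map.

  Each vector \<open>x\<^sub>k\<close> of the iterated construction is a Ritz vector whose value \<open>l\<^sub>k\<close> is the maximum
  attained (\<open>principal_vectors_ritz\<close>). Suppose that every Ritz value is simple, i.e. belongs
  to one line. Then \<open>l\<^sub>1 > \<dots> > l\<^sub>r\<close>, because orthogonal vectors do not share a line; and a Ritz
  value other than \<open>l\<^sub>1, \<dots>, l\<^bsub>r-1\<^esub>\<close> has a Ritz vector orthogonal to \<open>x\<^sub>1, \<dots>, x\<^bsub>r-1\<^esub>\<close>, which
  competes in the \<open>r\<close>-th maximisation, so the value is at most \<open>l\<^sub>r\<close>. Hence \<open>l\<^sub>r\<close> is the \<open>r\<close>-th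
  largest value (\<open>principal_value_nth_largest\<close>), and by simplicity \<open>x\<^sub>r\<close> and \<open>F u\<^sub>r\<close> span
  the same line.

  Simplicity is the genericity condition. It is expressed by polynomials through cyclic vectors
  rather than a discriminant: the compression \<open>C\<close> has simple eigenvalues iff
  \<open>v, C v, \<dots>, C\<^bsup>d-1\<^esup> v\<close> are linearly independent for some \<open>v\<close>, and for fixed \<open>v\<close> the determinant
  of these vectors is a polynomial in the data. The open set is where at least one of these determinants
  does not vanish. If it does not vanish, an eigenspace of dimension two or more would contain a
  nonzero vector orthogonal to \<open>v\<close>, hence to every \<open>C\<^bsup>k\<^esup> v\<close>, which is absurd
  (\<open>simple_ritz_values_if_cyclic\<close>). The open set is nonempty because some centred data make \<open>C\<close>
  diagonal with distinct entries (\<open>cyclic_tuple_exists\<close>). Centring lowers the rank of the data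
  to at most \<open>m - 1\<close>, which may be \<open>d - 1\<close>, so one of these entries is allowed to be \<open>0\<close>.
\<close>

section \<open>Ritz vectors\<close>

definition ritz_vector :: "(real^'n) set \<Rightarrow> real^'n^'n \<Rightarrow> real \<Rightarrow> real^'n \<Rightarrow> bool" where
  "ritz_vector \<Gamma> S l x \<longleftrightarrow> x \<in> \<Gamma> \<and> x \<noteq> 0 \<and> (\<forall>z\<in>\<Gamma>. z \<bullet> (S *v x) = l * (z \<bullet> x))"

lemma inner_transpose_mult:
  fixes F :: "real^'d^'n"
  shows "a \<bullet> (transpose F *v b) = (F *v a) \<bullet> b"
  by (simp add: inner_commute[of a] dot_lmul_matrix inner_commute[of b])

lemma symmetric_inner_commute:
  fixes S :: "real^'n^'n"
  assumes "transpose S = S"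
  shows "z \<bullet> (S *v x) = x \<bullet> (S *v z)"
  using inner_transpose_mult[of z S x] by (simp only: assms inner_commute)

lemma gen_eigenvector_iff_ritz_vector:
  fixes F :: "real^'d^'n"
  assumes "inj ((*v) F)" and "range ((*v) F) = \<Gamma>"
  shows "gen_eigenvector (transpose F ** S ** F) (transpose F ** F) l u \<longleftrightarrow> ritz_vector \<Gamma> S l (F *v u)"
proof -
  have nz: "F *v u = 0 \<longleftrightarrow> u = 0"
    using injD[OF assms(1), of u 0] by auto
  have lhs: "a \<bullet> ((transpose F ** S ** F) *v u) = (F *v a) \<bullet> (S *v (F *v u))" for a
    by (simp only: inner_transpose_mult matrix_vector_mul_assoc[symmetric])
  have rhs: "a \<bullet> (l *\<^sub>R ((transpose F ** F) *v u)) = l * ((F *v a) \<bullet> (F *v u))" for a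
    by (simp only: inner_transpose_mult matrix_vector_mul_assoc[symmetric] inner_scaleR_right)
  have "(transpose F ** S ** F) *v u = l *\<^sub>R ((transpose F ** F) *v u) \<longleftrightarrow>
      (\<forall>a. a \<bullet> ((transpose F ** S ** F) *v u) = a \<bullet> (l *\<^sub>R ((transpose F ** F) *v u)))"
    by (simp only: vector_eq_ldot)
  also have "\<dots> \<longleftrightarrow> (\<forall>z\<in>\<Gamma>. z \<bullet> (S *v (F *v u)) = l * (z \<bullet> (F *v u)))"
    unfolding lhs rhs assms(2)[symmetric] by auto
  finally show ?thesis
    using assms(2) nz unfolding gen_eigenvector_def ritz_vector_def by auto
qed

lemma gen_eigenvalue_iff_gen_eigenvector:
  "l \<in> gen_eigenvalues G H \<longleftrightarrow> (\<exists>u. gen_eigenvector G H l u)"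
proof -
  have "det (G - l *\<^sub>R H) = 0 \<longleftrightarrow> (\<exists>u. u \<noteq> 0 \<and> (G - l *\<^sub>R H) *v u = 0)"
    using invertible_det_nz[of "G - l *\<^sub>R H"]
    by (auto simp: invertible_left_inverse matrix_left_invertible_ker)
  then show ?thesis
    by (simp add: gen_eigenvalues_def gen_eigenvector_def matrix_vector_mult_diff_rdistrib
        scaleR_matrix_vector_assoc)
qed

lemma gen_eigenvalues_eq_ritz_values:
  fixes F :: "real^'d^'n"
  assumes "inj ((*v) F)" and "range ((*v) F) = \<Gamma>"
  shows "gen_eigenvalues (transpose F ** S ** F) (transpose F ** F) = {l. \<exists>x. ritz_vector \<Gamma> S l x}"
proof -
  have "(\<exists>u. ritz_vector \<Gamma> S l (F *v u)) \<longleftrightarrow> (\<exists>x. ritz_vector \<Gamma> S l x)" for l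
  proof
    assume "\<exists>x. ritz_vector \<Gamma> S l x"
    then obtain x where x: "ritz_vector \<Gamma> S l x" ..
    then have "x \<in> range ((*v) F)"
      by (simp add: ritz_vector_def assms(2))
    with x show "\<exists>u. ritz_vector \<Gamma> S l (F *v u)"
      by blast
  qed blast
  then show ?thesis
    by (simp add: set_eq_iff gen_eigenvalue_iff_gen_eigenvector gen_eigenvector_iff_ritz_vector[OF assms])
qed

lemma ritz_vector_scaleR:
  assumes "subspace \<Gamma>" "ritz_vector \<Gamma> S l x" "c \<noteq> 0"
  shows "ritz_vector \<Gamma> S l (c *\<^sub>R x)"
  using assms by (simp add: ritz_vector_def subspace_scale matrix_vector_mult_scaleR)

lemma ritz_vector_value:
  assumes "ritz_vector \<Gamma> S l x" "norm x = 1"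
  shows "x \<bullet> (S *v x) = l"
  using assms by (auto simp: ritz_vector_def norm_eq_1)

lemma ritz_vectors_orthogonal:
  assumes S: "transpose S = S" and "ritz_vector \<Gamma> S l x" "ritz_vector \<Gamma> S k z" "l \<noteq> k"
  shows "orthogonal z x"
proof -
  have "l * (z \<bullet> x) = z \<bullet> (S *v x)" "k * (x \<bullet> z) = x \<bullet> (S *v z)"
    using assms by (auto simp: ritz_vector_def)
  then have "l * (z \<bullet> x) = k * (z \<bullet> x)"
    using symmetric_inner_commute[OF S, of z x] by (simp add: inner_commute)
  then show ?thesis
    using assms(4) by (simp add: orthogonal_def)
qed

section \<open>Iterated maximisation of the variance\<close>

text \<open>
  The value at \<open>t = - a / K\<close> with \<open>K > c\<close> is negative unless \<open>a = 0\<close>.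
\<close>

lemma nonneg_quadratic_linear_coeff_zero:
  fixes a c :: real
  assumes "\<And>t. a * t + c * t^2 \<ge> 0"
  shows "a = 0"
proof (rule ccontr)
  assume "a \<noteq> 0"
  define K where "K = \<bar>c\<bar> + 1"
  have K: "K > 0" "c < K"
    by (auto simp: K_def)
  have "a * (- a / K) + c * (- a / K)^2 = a^2 * (c - K) / K^2"
    using K by (simp add: field_simps power2_eq_square)
  moreover have "\<dots> < 0"
    using K \<open>a \<noteq> 0\<close> by (simp add: divide_neg_pos mult_pos_neg)
  ultimately show False
    using assms[of "- a / K"] by linarith
qed

text \<open>
  By homogeneity \<open>l (w \<bullet> w) - w \<bullet> S w \<ge> 0\<close> on all of \<open>V\<close>, with equality at \<open>x\<close>. Along
  \<open>w = x + t z\<close> this is a nonnegative quadratic in \<open>t\<close> without constant term, so its linear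
  coefficient vanishes.
\<close>

lemma rayleigh_maximiser_stationary:
  fixes S :: "real^'n^'n"
  assumes S: "transpose S = S" and V: "subspace V" and x: "x \<in> V" "norm x = 1"
    and max: "\<And>z. z \<in> V \<Longrightarrow> norm z = 1 \<Longrightarrow> z \<bullet> (S *v z) \<le> x \<bullet> (S *v x)"
    and z: "z \<in> V"
  shows "z \<bullet> (S *v x) = (x \<bullet> (S *v x)) * (z \<bullet> x)"
proof -
  define l where "l = x \<bullet> (S *v x)"
  have le: "w \<bullet> (S *v w) \<le> l * (w \<bullet> w)" if "w \<in> V" for w
  proof (cases "w = 0")
    case False
    let ?w = "(1 / norm w) *\<^sub>R w"
    have "?w \<bullet> (S *v ?w) \<le> l"
      unfolding l_def using False that V by (intro max) (auto simp: subspace_scale)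
    then have "(w \<bullet> (S *v w)) / (norm w)^2 \<le> l"
      by (simp add: matrix_vector_mult_scaleR power2_eq_square)
    then show ?thesis
      using False by (simp add: divide_le_eq power2_norm_eq_inner)
  qed simp
  have "(2 * (l * (z \<bullet> x) - z \<bullet> (S *v x))) * t + (l * (z \<bullet> z) - z \<bullet> (S *v z)) * t^2 \<ge> 0" for t
  proof -
    have "x + t *\<^sub>R z \<in> V"
      using V x z by (simp add: subspace_add subspace_scale)
    from le[OF this] show ?thesis
      using x(2) symmetric_inner_commute[OF S, of x z]
      by (simp add: matrix_vector_right_distrib matrix_vector_mult_scaleR inner_simps
          norm_eq_1 l_def[symmetric] inner_commute[of x z] algebra_simps power2_eq_square)
  qed
  from nonneg_quadratic_linear_coeff_zero[OF this] show ?thesis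
    by (simp add: l_def)
qed

text \<open>
  The space over which the \<open>k\<close>-th maximisation takes place.
\<close>

definition deflated :: "(real^'n) set \<Rightarrow> (nat \<Rightarrow> real^'n) \<Rightarrow> nat \<Rightarrow> (real^'n) set" where
  "deflated \<Gamma> x k = {z \<in> \<Gamma>. \<forall>j\<in>{1..<k}. orthogonal z (x j)}"

lemma subspace_deflated: "subspace \<Gamma> \<Longrightarrow> subspace (deflated \<Gamma> x k)"
  unfolding deflated_def subspace_def
  by (auto simp: orthogonal_clauses)

lemma principal_vectorsD:
  assumes "principal_vectors \<Gamma> D r x" "k \<in> {1..r}"
  shows "x k \<in> \<Gamma>" "norm (x k) = 1" "x k \<in> deflated \<Gamma> x k"
    and "\<And>z. z \<in> deflated \<Gamma> x k \<Longrightarrow> norm z = 1 \<Longrightarrow>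
           z \<bullet> (sample_covariance D *v z) \<le> x k \<bullet> (sample_covariance D *v x k)"
  using assms by (auto simp: principal_vectors_def is_arg_max_linorder deflated_def)

lemma principal_vectors_orthogonal:
  assumes "principal_vectors \<Gamma> D r x" "i \<in> {1..r}" "j \<in> {1..r}" "i \<noteq> j"
  shows "x i \<bullet> x j = 0"
proof (cases "i < j")
  case True
  then show ?thesis
    using principal_vectorsD(3)[OF assms(1,3)] assms(2)
    by (auto simp: deflated_def orthogonal_def inner_commute)
next
  case False
  then show ?thesis
    using principal_vectorsD(3)[OF assms(1,2)] assms(3,4)
    by (auto simp: deflated_def orthogonal_def)
qed

text \<open>
  Stationarity gives the Ritz equation against the deflated space only. Against an earlier \<open>x j\<close>
  both sides vanish, since \<open>x j\<close> is itself a Ritz vector by induction and \<open>S\<close> is symmetric; and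
  \<open>\<Gamma>\<close> is the sum of the deflated space and the span of the earlier vectors.
\<close>

lemma principal_vectors_ritz:
  assumes S: "transpose (sample_covariance D) = sample_covariance D" and \<Gamma>: "subspace \<Gamma>"
    and x: "principal_vectors \<Gamma> D r x" and k: "k \<in> {1..r}"
  shows "ritz_vector \<Gamma> (sample_covariance D) (x k \<bullet> (sample_covariance D *v x k)) (x k)"
  using k
proof (induction k rule: less_induct)
  case (less k)
  let ?S = "sample_covariance D"
  let ?l = "\<lambda>k. x k \<bullet> (?S *v x k)"
  note xk = principal_vectorsD[OF x less.prems]
  have old: "x j \<bullet> (?S *v x k) = 0" "x j \<bullet> x k = 0" if "j \<in> {1..<k}" for j
  proof -
    have j: "j \<in> {1..r}" "j < k"
      using that less.prems by auto
    show 0: "x j \<bullet> x k = 0"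
      using principal_vectors_orthogonal[OF x j(1) less.prems] j(2) by simp
    have "x k \<bullet> (?S *v x j) = ?l j * (x k \<bullet> x j)"
      using less.IH[OF j(2,1)] xk(1) unfolding ritz_vector_def by blast
    then show "x j \<bullet> (?S *v x k) = 0"
      using 0 symmetric_inner_commute[OF S, of "x j" "x k"] by (simp add: inner_commute)
  qed
  have "z \<bullet> (?S *v x k) = ?l k * (z \<bullet> x k)" if z: "z \<in> \<Gamma>" for z
  proof -
    define p where "p = (\<Sum>j\<in>{1..<k}. (z \<bullet> x j) *\<^sub>R x j)"
    have "p \<in> \<Gamma>"
      unfolding p_def using \<Gamma> less.prems principal_vectorsD(1)[OF x]
      by (intro subspace_sum subspace_scale) auto
    moreover have "p \<bullet> x i = z \<bullet> x i" if i: "i \<in> {1..<k}" for i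
    proof -
      have "(z \<bullet> x j) * (x j \<bullet> x i) = (if j = i then z \<bullet> x i else 0)" if "j \<in> {1..<k}" for j
        using that i less.prems principal_vectors_orthogonal[OF x, of j i]
          principal_vectorsD(2)[OF x, of i]
        by (auto simp: norm_eq_1)
      then have "p \<bullet> x i = (\<Sum>j\<in>{1..<k}. if j = i then z \<bullet> x i else 0)"
        by (simp add: p_def inner_sum_left)
      then show ?thesis
        using i by simp
    qed
    ultimately have "z - p \<in> deflated \<Gamma> x k"
      using z \<Gamma> by (auto simp: deflated_def orthogonal_def inner_diff_left subspace_diff)
    from rayleigh_maximiser_stationary[OF S subspace_deflated[OF \<Gamma>] xk(3,2) xk(4) this]
    have "(z - p) \<bullet> (?S *v x k) = ?l k * ((z - p) \<bullet> x k)"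
      by blast
    moreover have "p \<bullet> (?S *v x k) = 0" "p \<bullet> x k = 0"
      unfolding p_def using old by (simp_all add: inner_sum_left)
    ultimately show ?thesis
      by (simp add: inner_diff_left)
  qed
  moreover have "x k \<noteq> 0"
    using xk(2) by auto
  ultimately show ?case
    using xk(1) unfolding ritz_vector_def by blast
qed

text \<open>
  The \<open>r\<close> vectors found so far do not span \<open>\<Gamma>\<close>, so the unit sphere of the deflated space is
  nonempty; it is compact, so the next maximum is attained.
\<close>

lemma principal_vectors_exist:
  assumes \<Gamma>: "subspace \<Gamma>" and "r \<le> dim \<Gamma>"
  shows "\<exists>x. principal_vectors \<Gamma> D r x"
  using assms(2)
proof (induction r)
  case 0
  then show ?case
    by (simp add: principal_vectors_def)
next
  case (Suc r)
  let ?S = "sample_covariance D"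
  from Suc obtain x where x: "principal_vectors \<Gamma> D r x"
    by auto
  let ?K = "deflated \<Gamma> x (Suc r) \<inter> sphere 0 1"
  have "span (x ` {1..r}) \<subset> span \<Gamma>"
  proof
    show "span (x ` {1..r}) \<subseteq> span \<Gamma>"
      using principal_vectorsD(1)[OF x] by (intro span_mono) auto
    have "dim (x ` {1..r}) \<le> card (x ` {1..r})"
      by (intro dim_le_card') auto
    also have "\<dots> \<le> r"
      using card_image_le[of "{1..r}" x] by simp
    finally show "span (x ` {1..r}) \<noteq> span \<Gamma>"
      using Suc.prems by (metis dim_span not_less_eq_eq)
  qed
  from orthogonal_to_subspace_exists_gen[OF this]
  obtain z where z: "z \<noteq> 0" "z \<in> span \<Gamma>" "\<And>y. y \<in> span (x ` {1..r}) \<Longrightarrow> orthogonal z y"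
    by blast
  have "z \<in> deflated \<Gamma> x (Suc r)"
    using z(2,3) \<Gamma> by (auto simp: deflated_def span_base span_eq_iff[THEN iffD2])
  then have "(1 / norm z) *\<^sub>R z \<in> ?K"
    using z(1) subspace_deflated[OF \<Gamma>] by (simp add: subspace_scale)
  then have "?K \<noteq> {}"
    by blast
  moreover have "compact ?K"
    using subspace_deflated[OF \<Gamma>] by (intro closed_Int_compact closed_subspace) auto
  moreover have "continuous_on ?K (\<lambda>z. z \<bullet> (?S *v z))"
    by (intro continuous_intros)
  ultimately have "\<exists>w\<in>?K. \<forall>z\<in>?K. z \<bullet> (?S *v z) \<le> w \<bullet> (?S *v w)"
    using continuous_attains_sup[of ?K "\<lambda>z. z \<bullet> (?S *v z)"] by blast
  then obtain w where w: "w \<in> ?K" "\<And>z. z \<in> ?K \<Longrightarrow> z \<bullet> (?S *v z) \<le> w \<bullet> (?S *v w)"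
    by blast
  have "principal_vectors \<Gamma> D (Suc r) (x(Suc r := w))"
    unfolding principal_vectors_def
  proof
    fix k assume k: "k \<in> {1..Suc r}"
    show "is_arg_max (\<lambda>z. z \<bullet> (?S *v z))
        (\<lambda>z. z \<in> \<Gamma> \<and> norm z = 1 \<and> (\<forall>j\<in>{1..<k}. orthogonal z ((x(Suc r := w)) j)))
        ((x(Suc r := w)) k)"
    proof (cases "k = Suc r")
      case True
      then show ?thesis
        using w by (auto simp: is_arg_max_linorder deflated_def)
    next
      case False
      then show ?thesis
        using x k by (auto simp: principal_vectors_def is_arg_max_linorder)
    qed
  qed
  then show ?case
    by blast
qed

definition simple_ritz_values :: "(real^'n) set \<Rightarrow> real^'n^'n \<Rightarrow> bool" where
  "simple_ritz_values \<Gamma> S \<longleftrightarrow>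
     (\<forall>l x z. ritz_vector \<Gamma> S l x \<and> ritz_vector \<Gamma> S l z \<longrightarrow> span {x} = span {z})"

text \<open>
  The Ritz values above the \<open>r\<close>-th maximum are exactly the \<open>r - 1\<close> earlier maxima.
\<close>

lemma principal_value_nth_largest:
  assumes S: "transpose (sample_covariance D) = sample_covariance D" and \<Gamma>: "subspace \<Gamma>"
    and simple: "simple_ritz_values \<Gamma> (sample_covariance D)"
    and x: "principal_vectors \<Gamma> D r x" and r: "1 \<le> r"
  shows "is_nth_largest r {l. \<exists>x. ritz_vector \<Gamma> (sample_covariance D) l x}
           (x r \<bullet> (sample_covariance D *v x r))"
proof -
  let ?S = "sample_covariance D"
  let ?l = "\<lambda>k. x k \<bullet> (?S *v x k)"
  note ritz = principal_vectors_ritz[OF S \<Gamma> x]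
  \<comment> \<open>A later vector already competed earlier, and a tie would put two orthogonal vectors on one line.\<close>
  have less: "?l j < ?l i" if ij: "i \<in> {1..r}" "j \<in> {1..r}" "i < j" for i j
  proof -
    have "x j \<in> deflated \<Gamma> x i"
      using principal_vectorsD(3)[OF x ij(2)] ij(3) by (auto simp: deflated_def)
    then have "?l j \<le> ?l i"
      using principal_vectorsD(4)[OF x ij(1)] principal_vectorsD(2)[OF x ij(2)] by blast
    moreover have "?l j \<noteq> ?l i"
    proof
      assume eq: "?l j = ?l i"
      have "span {x i} = span {x j}"
        using simple ritz[OF ij(1)] ritz[OF ij(2)] eq unfolding simple_ritz_values_def by metis
      then have "x i \<in> span {x j}"
        by (metis insertI1 span_base)
      then obtain c where c: "x i = c *\<^sub>R x j"
        by (auto simp: span_singleton)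
      have "x i \<bullet> x i = c * (x i \<bullet> x j)"
        using arg_cong[OF c, of "\<lambda>w. x i \<bullet> w"] by simp
      then show False
        using principal_vectors_orthogonal[OF x ij(1,2)] ij(3)
          principal_vectorsD(2)[OF x ij(1)] by (simp add: norm_eq_1)
    qed
    ultimately show ?thesis
      by simp
  qed
  have "{k \<in> {l. \<exists>x. ritz_vector \<Gamma> ?S l x}. ?l r < k} = ?l ` {1..<r}"
  proof (intro equalityI subsetI)
    fix k assume "k \<in> {k \<in> {l. \<exists>x. ritz_vector \<Gamma> ?S l x}. ?l r < k}"
    then obtain z where z: "ritz_vector \<Gamma> ?S k z" and k: "?l r < k"
      by auto
    show "k \<in> ?l ` {1..<r}"
    proof (rule ccontr)
      assume nk: "k \<notin> ?l ` {1..<r}"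
      let ?z = "(1 / norm z) *\<^sub>R z"
      have nz: "z \<noteq> 0"
        using z by (simp add: ritz_vector_def)
      then have z': "ritz_vector \<Gamma> ?S k ?z" "norm ?z = 1"
        using ritz_vector_scaleR[OF \<Gamma> z] by auto
      have "orthogonal ?z (x j)" if "j \<in> {1..<r}" for j
      proof (rule ritz_vectors_orthogonal[OF S ritz z'(1)])
        show "j \<in> {1..r}" "?l j \<noteq> k"
          using nk that by auto
      qed
      then have "?z \<in> deflated \<Gamma> x r"
        using z'(1) by (auto simp: deflated_def ritz_vector_def)
      then have "?z \<bullet> (?S *v ?z) \<le> ?l r"
        using principal_vectorsD(4)[OF x, of r ?z] r z'(2) by auto
      then show False
        using ritz_vector_value[OF z'] k by simp
    qed
  next
    fix k assume "k \<in> ?l ` {1..<r}"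
    then obtain j where "j \<in> {1..<r}" "k = ?l j"
      by auto
    then show "k \<in> {k \<in> {l. \<exists>x. ritz_vector \<Gamma> ?S l x}. ?l r < k}"
      using ritz[of j] less[of j r] by auto
  qed
  moreover have "inj_on ?l {1..<r}"
  proof (rule linorder_inj_onI')
    fix i j assume "i \<in> {1..<r}" "j \<in> {1..<r}" "i < j"
    then show "?l i \<noteq> ?l j"
      using less[of i j] by auto
  qed
  ultimately show ?thesis
    using ritz[of r] r by (auto simp: is_nth_largest_def card_image)
qed

lemma is_nth_largest_unique:
  assumes "is_nth_largest r E l" "is_nth_largest r E k"
  shows "l = k"
proof -
  have "\<not> a < b" if "is_nth_largest r E a" "is_nth_largest r E b" for a b
  proof
    assume "a < b"
    then have "{c \<in> E. b < c} \<subset> {c \<in> E. a < c}"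
      using that by (auto simp: is_nth_largest_def)
    then have "card {c \<in> E. b < c} < card {c \<in> E. a < c}"
      using that(1) by (intro psubset_card_mono) (simp_all add: is_nth_largest_def)
    then show False
      using that by (simp add: is_nth_largest_def)
  qed
  with assms show ?thesis
    by (meson linorder_neqE)
qed

text \<open>
  Principal vectors are determined only up to sign, and the definition does not presuppose that
  they exist or that the line is unique: both follow here from simplicity.
\<close>

lemma principal_component_iff_ritz:
  assumes S: "transpose (sample_covariance D) = sample_covariance D" and \<Gamma>: "subspace \<Gamma>"
    and simple: "simple_ritz_values \<Gamma> (sample_covariance D)"
    and r: "r \<in> {1..dim \<Gamma>}"
  defines "E \<equiv> {l. \<exists>x. ritz_vector \<Gamma> (sample_covariance D) l x}"
  shows "\<exists>l. is_nth_largest r E l"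
    and "is_nth_largest r E l \<Longrightarrow> ritz_vector \<Gamma> (sample_covariance D) l w \<Longrightarrow>
           is_principal_component \<Gamma> D r L \<longleftrightarrow> L = span {w}"
proof -
  obtain x where x: "principal_vectors \<Gamma> D r x"
    using principal_vectors_exist[OF \<Gamma>] r by (metis atLeastAtMost_iff)
  then show "\<exists>l. is_nth_largest r E l"
    using principal_value_nth_largest[OF S \<Gamma> simple x] r unfolding E_def by auto
  assume l: "is_nth_largest r E l" and w: "ritz_vector \<Gamma> (sample_covariance D) l w"
  have "span {x r} = span {w}" if "principal_vectors \<Gamma> D r x" for x
  proof -
    have "ritz_vector \<Gamma> (sample_covariance D) (x r \<bullet> (sample_covariance D *v x r)) (x r)"
      using principal_vectors_ritz[OF S \<Gamma> that] r by simp
    moreover have "x r \<bullet> (sample_covariance D *v x r) = l"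
      using principal_value_nth_largest[OF S \<Gamma> simple that] r l is_nth_largest_unique
      unfolding E_def by auto
    ultimately show ?thesis
      using simple w unfolding simple_ritz_values_def by metis
  qed
  then show "is_principal_component \<Gamma> D r L \<longleftrightarrow> L = span {w}"
    using x unfolding is_principal_component_def by metis
qed

section \<open>Cyclic vectors\<close>

text \<open>
  The rows are \<open>C\<^bsup>k\<^esup> v\<close>; \<open>idx\<close> enumerates the index type so that rows can be labelled by the
  exponents \<open>0, \<dots>, d - 1\<close>.
\<close>

definition krylov_matrix :: "('d \<Rightarrow> nat) \<Rightarrow> real^'d^'d \<Rightarrow> real^'d \<Rightarrow> real^'d^'d" where
  "krylov_matrix idx C v = (\<chi> i. (((*v) C) ^^ idx i) v)"

text \<open>
  For an orthonormal family \<open>e\<close> with span \<open>\<Gamma>\<close> this is the matrix of \<open>S\<close> on \<open>\<Gamma>\<close> followed by the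
  orthogonal projection onto \<open>\<Gamma>\<close>.
\<close>

definition compression :: "('d \<Rightarrow> real^'n) \<Rightarrow> real^'n^'n \<Rightarrow> real^'d^'d" where
  "compression e S = (\<chi> i j. e i \<bullet> (S *v e j))"

text \<open>
  By symmetry \<open>a \<bullet> C\<^bsup>k\<^esup> v = l\<^sup>k (a \<bullet> v) = 0\<close>, so \<open>a\<close> lies in the kernel of the Krylov matrix.
\<close>

lemma eigenvector_not_orthogonal_cyclic:
  fixes C :: "real^'d^'d"
  assumes C: "transpose C = C" and det: "det (krylov_matrix idx C v) \<noteq> 0"
    and a: "C *v a = l *\<^sub>R a" "a \<bullet> v = 0"
  shows "a = 0"
proof -
  have "a \<bullet> ((((*v) C) ^^ k) v) = 0" for k
  proof (induction k)
    case (Suc k)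
    then show ?case
      using symmetric_inner_commute[OF C, of a "(((*v) C) ^^ k) v"] a(1)
      by (simp add: inner_commute)
  qed (simp add: a)
  then have "krylov_matrix idx C v *v a = 0"
    by (simp add: vec_eq_iff krylov_matrix_def matrix_vector_mul_component inner_commute)
  then show ?thesis
    using det by (metis invertible_det_nz invertible_left_inverse matrix_left_invertible_ker)
qed

lemma orthonormal_expansion:
  fixes e :: "'d::finite \<Rightarrow> real^'n"
  assumes e: "\<And>i j. e i \<bullet> e j = (if i = j then 1 else 0)" and "x \<in> span (range e)"
  shows "x = (\<Sum>i\<in>UNIV. (e i \<bullet> x) *\<^sub>R e i)"
proof -
  have "linear (\<lambda>x. \<Sum>i\<in>UNIV. (e i \<bullet> x) *\<^sub>R e i)"
    by (intro linearI)
      (simp_all add: inner_add_right scaleR_add_left sum.distrib scaleR_sum_right)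
  moreover have "(\<Sum>i\<in>UNIV. (e i \<bullet> e j) *\<^sub>R e i) = e j" for j
  proof -
    have "(\<Sum>i\<in>UNIV. (e i \<bullet> e j) *\<^sub>R e i) = (\<Sum>i\<in>UNIV. if i = j then e i else 0)"
      by (intro sum.cong) (simp_all add: e)
    then show ?thesis
      by simp
  qed
  ultimately show ?thesis
    using linear_eq_on_span[OF linear_id[unfolded id_def] _ _ assms(2)] by fastforce
qed

text \<open>
  Two Ritz vectors \<open>x\<close>, \<open>z\<close> for one value have the combination \<open>(z \<bullet> w) x - (x \<bullet> w) z\<close>, which is
  orthogonal to the cyclic vector \<open>w\<close> and therefore zero; and \<open>x \<bullet> w\<close>, \<open>z \<bullet> w\<close> are nonzero by
  the same argument.
\<close>

lemma simple_ritz_values_if_cyclic: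
  fixes e :: "'d::finite \<Rightarrow> real^'n"
  assumes S: "transpose S = S" and \<Gamma>: "subspace \<Gamma>"
    and e: "\<And>i j. e i \<bullet> e j = (if i = j then 1 else 0)" "span (range e) = \<Gamma>"
    and det: "det (krylov_matrix idx (compression e S) v) \<noteq> 0"
  shows "simple_ritz_values \<Gamma> S"
proof -
  define w where "w = (\<Sum>i\<in>UNIV. v $ i *\<^sub>R e i)"
  have C: "transpose (compression e S) = compression e S"
    by (simp add: compression_def transpose_def vec_eq_iff symmetric_inner_commute[OF S])
  have zero: "x = 0" if x: "x \<in> \<Gamma>" "\<And>z. z \<in> \<Gamma> \<Longrightarrow> z \<bullet> (S *v x) = l * (z \<bullet> x)" "x \<bullet> w = 0" for l x
  proof -
    define a where "a = (\<chi> i. e i \<bullet> x)"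
    have xa: "x = (\<Sum>i\<in>UNIV. a $ i *\<^sub>R e i)"
      using orthonormal_expansion[OF e(1)] x(1) e(2) by (simp add: a_def)
    have "(compression e S *v a) $ i = (l *\<^sub>R a) $ i" for i
    proof -
      have "S *v x = (\<Sum>j\<in>UNIV. a $ j *\<^sub>R (S *v e j))"
        by (subst xa)
          (simp add: linear_sum[OF matrix_vector_mul_linear] matrix_vector_mult_scaleR)
      then have "(compression e S *v a) $ i = e i \<bullet> (S *v x)"
        by (simp add: matrix_vector_mul_component compression_def inner_sum_right
            inner_vec_def[of _ a] mult.commute)
      also have "\<dots> = l * (e i \<bullet> x)"
        using x(2) e(2) by (metis rangeI span_base)
      finally show ?thesis
        by (simp add: a_def)
    qed
    then have "compression e S *v a = l *\<^sub>R a"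
      by (simp add: vec_eq_iff)
    moreover have "a \<bullet> v = x \<bullet> w"
      unfolding w_def inner_sum_right inner_vec_def[of a]
      by (simp add: a_def inner_commute[of x] mult.commute)
    ultimately have "a = 0"
      using eigenvector_not_orthogonal_cyclic[OF C det, of a l] x(3) by simp
    then show ?thesis
      using xa by simp
  qed
  show ?thesis
    unfolding simple_ritz_values_def
  proof (intro allI impI, elim conjE)
    fix l x z assume x: "ritz_vector \<Gamma> S l x" and z: "ritz_vector \<Gamma> S l z"
    have nz: "x \<bullet> w \<noteq> 0" "z \<bullet> w \<noteq> 0"
      using zero[of x l] zero[of z l] x z by (auto simp: ritz_vector_def)
    have "(z \<bullet> w) *\<^sub>R x - (x \<bullet> w) *\<^sub>R z = 0"
    proof (rule zero[where l = l])
      show "(z \<bullet> w) *\<^sub>R x - (x \<bullet> w) *\<^sub>R z \<in> \<Gamma>"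
        using x z \<Gamma> by (auto simp: ritz_vector_def subspace_diff subspace_scale)
      show "y \<bullet> (S *v ((z \<bullet> w) *\<^sub>R x - (x \<bullet> w) *\<^sub>R z)) = l * (y \<bullet> ((z \<bullet> w) *\<^sub>R x - (x \<bullet> w) *\<^sub>R z))"
        if "y \<in> \<Gamma>" for y
        using x z that by (auto simp: ritz_vector_def matrix_vector_mult_diff_distrib
            matrix_vector_mult_scaleR inner_diff_right algebra_simps)
    qed (simp add: inner_diff_left)
    then have "x = ((x \<bullet> w) / (z \<bullet> w)) *\<^sub>R z"
      using nz by (simp add: eq_vector_fraction_iff)
    then show "span {x} = span {z}"
      using nz span_image_scale[of "{z}" "\<lambda>_. (x \<bullet> w) / (z \<bullet> w)"] by simp
  qed
qed

text \<open>
  For the all-ones vector the Krylov matrix is a Vandermonde matrix: a linear relation among its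
  rows is a polynomial of degree less than \<open>d\<close> with the \<open>d\<close> diagonal entries as roots.
\<close>

lemma cyclic_if_diagonal_distinct:
  fixes idx :: "'d::finite \<Rightarrow> nat" and C :: "real^'d^'d"
  assumes idx: "bij_betw idx UNIV {..<CARD('d)}"
    and C: "\<And>i j. C $ i $ j = (if i = j then f i else 0)" and f: "inj f"
  shows "det (krylov_matrix idx C 1) \<noteq> 0"
proof -
  have mult: "(C *v a) $ i = f i * a $ i" for a i
  proof -
    have "(C *v a) $ i = (\<Sum>j\<in>UNIV. if i = j then f i * a $ j else 0)"
      unfolding matrix_vector_mult_def vec_lambda_beta by (intro sum.cong) (simp_all add: C)
    then show ?thesis
      by simp
  qed
  have pow: "((((*v) C) ^^ k) 1) $ i = f i ^ k" for k i
    by (induction k) (simp_all add: mult)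
  have "a = 0" if a: "transpose (krylov_matrix idx C 1) *v a = 0" for a
  proof (rule ccontr)
    assume "a \<noteq> 0"
    then obtain i0 where i0: "a $ i0 \<noteq> 0"
      by (auto simp: vec_eq_iff)
    define c where "c k = a $ inv_into UNIV idx k" for k
    have inj: "inj idx"
      using idx by (simp add: bij_betw_def)
    have "idx i0 < CARD('d)"
      using idx by (auto simp: bij_betw_def)
    then have le: "idx i0 \<le> CARD('d) - 1"
      by simp
    have c0: "c (idx i0) \<noteq> 0"
      using i0 inj by (simp add: c_def)
    have "(\<Sum>k\<le>CARD('d) - 1. c k * f i ^ k) = 0" for i
    proof -
      have "{..CARD('d) - 1} = {..<CARD('d)}"
        using lessThan_Suc_atMost[of "CARD('d) - 1"] by simp
      then have "(\<Sum>k\<le>CARD('d) - 1. c k * f i ^ k) = (\<Sum>j\<in>UNIV. c (idx j) * f i ^ idx j)"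
        using sum.reindex_bij_betw[OF idx, of "\<lambda>k. c k * f i ^ k"] by simp
      also have "\<dots> = (transpose (krylov_matrix idx C 1) *v a) $ i"
        using inj by (simp add: matrix_vector_mult_def transpose_def krylov_matrix_def pow c_def mult.commute)
      finally show ?thesis
        using a by simp
    qed
    then have "range f \<subseteq> {z. (\<Sum>k\<le>CARD('d) - 1. c k * z ^ k) = 0}"
      by auto
    then have "card (range f) \<le> CARD('d) - 1"
      using polyfun_rootbound[of "CARD('d) - 1" c] le c0 by (meson card_mono order_trans)
    then show False
      using f by (simp add: card_image) (metis Suc_pred less_irrefl zero_less_card_finite lessI not_less)
  qed
  then have "det (transpose (krylov_matrix idx C 1)) \<noteq> 0"
    by (metis invertible_det_nz invertible_left_inverse matrix_left_invertible_ker)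
  then show ?thesis
    by simp
qed

section \<open>The covariance of a tuple\<close>

text \<open>
  The covariance as a polynomial in the tuple. For a tuple with repeated entries it can differ from
  \<^const>\<open>sample_covariance\<close> of the underlying set.
\<close>

definition tuple_covariance :: "real^'n^'m \<Rightarrow> real^'n^'n" where
  "tuple_covariance y = (1 / real CARD('m)) *\<^sub>R (transpose y ** y)"

lemma sample_covariance_range:
  fixes y :: "real^'n^'m"
  assumes "card (range (\<lambda>i. y $ i)) = CARD('m)"
  shows "sample_covariance (range (\<lambda>i. y $ i)) = tuple_covariance y"
proof -
  have "inj (\<lambda>i. y $ i)"
    using assms by (simp add: eq_card_imp_inj_on)
  then have "(\<Sum>z\<in>range (\<lambda>i. y $ i). columnvector z ** transpose (columnvector z :: real^1^'n))
      = (\<Sum>i\<in>UNIV. columnvector (y $ i) ** transpose (columnvector (y $ i) :: real^1^'n))"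
    by (subst sum.reindex) auto
  also have "\<dots> = transpose y ** y"
    by (simp add: vec_eq_iff columnvector_def matrix_matrix_mult_def transpose_def)
  finally show ?thesis
    by (simp add: sample_covariance_def tuple_covariance_def assms)
qed

lemma transpose_tuple_covariance: "transpose (tuple_covariance y) = tuple_covariance y"
  by (simp add: tuple_covariance_def transpose_scalar matrix_transpose_mul)

lemma inner_tuple_covariance:
  fixes y :: "real^'n^'m"
  shows "a \<bullet> (tuple_covariance y *v b) = (1 / real CARD('m)) * (\<Sum>k\<in>UNIV. (y $ k \<bullet> a) * (y $ k \<bullet> b))"
proof -
  have "a \<bullet> ((transpose y ** y) *v b) = (y *v a) \<bullet> (y *v b)"
    by (simp only: inner_transpose_mult matrix_vector_mul_assoc[symmetric])
  then show ?thesis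
    by (simp add: tuple_covariance_def scaleR_matrix_vector_assoc[symmetric] inner_vec_def[of "y *v a"]
        matrix_vector_mul_component)
qed

lemma real_polynomial_function_det:
  fixes K :: "'a::real_normed_vector \<Rightarrow> real^'d^'d"
  assumes "\<And>i j. real_polynomial_function (\<lambda>y. K y $ i $ j)"
  shows "real_polynomial_function (\<lambda>y. det (K y))"
  unfolding det_def
  by (intro real_polynomial_function_sum real_polynomial_function.intros(4)
      real_polynomial_function.intros(2) real_polynomial_function_prod)
    (simp_all add: finite_permutations assms)

text \<open>
  This makes the genericity condition Zariski open.
\<close>

lemma real_polynomial_function_krylov:
  fixes C :: "'a::real_normed_vector \<Rightarrow> real^'d^'d"
  assumes "\<And>i j. real_polynomial_function (\<lambda>y. C y $ i $ j)"
  shows "real_polynomial_function (\<lambda>y. det (krylov_matrix idx (C y) v))"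
proof -
  have "real_polynomial_function (\<lambda>y. ((((*v) (C y)) ^^ k) v) $ i)" for k i
  proof (induction k arbitrary: i)
    case (Suc k)
    have "(\<lambda>y. ((((*v) (C y)) ^^ Suc k) v) $ i) =
        (\<lambda>y. \<Sum>j\<in>UNIV. C y $ i $ j * ((((*v) (C y)) ^^ k) v) $ j)"
      unfolding funpow.simps o_apply matrix_vector_mul_component inner_vec_def by simp
    then show ?case
      using assms Suc.IH by (simp add: real_polynomial_function_sum real_polynomial_function.intros(4))
  qed auto
  then show ?thesis
    by (intro real_polynomial_function_det) (simp add: krylov_matrix_def)
qed

lemma real_polynomial_function_compression:
  fixes e :: "'d::finite \<Rightarrow> real^'n"
  shows "real_polynomial_function (\<lambda>y::real^'n^'m. compression e (tuple_covariance y) $ i $ j)"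
proof -
  have "bounded_linear (\<lambda>y::real^'n^'m. y $ k \<bullet> a)" for k a
    by (intro bounded_linear_intros bounded_linear_vec_nth)
  then show ?thesis
    unfolding compression_def inner_tuple_covariance vec_lambda_beta
    by (intro real_polynomial_function.intros(4) real_polynomial_function.intros(2)
        real_polynomial_function_sum real_polynomial_function.intros(1)) simp_all
qed

lemma orthonormal_family:
  fixes \<Gamma> :: "(real^'n) set"
  assumes "subspace \<Gamma>" "CARD('d::finite) = dim \<Gamma>"
  obtains e :: "'d::finite \<Rightarrow> real^'n"
  where "\<And>i j. e i \<bullet> e j = (if i = j then 1 else 0)" "span (range e) = \<Gamma>"
proof -
  obtain B where B: "pairwise orthogonal B" "\<And>x. x \<in> B \<Longrightarrow> norm x = 1"
    "independent B" "card B = dim \<Gamma>" "span B = \<Gamma>"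
    using orthonormal_basis_subspace[OF assms(1)] by metis
  obtain e :: "'d \<Rightarrow> real^'n" where e: "bij_betw e UNIV B"
    using B assms(2) independent_imp_finite finite_same_card_bij[of "UNIV :: 'd set" B] by auto
  have eB: "e i \<in> B" for i
    using e by (auto simp: bij_betw_def)
  have "e i \<bullet> e j = (if i = j then 1 else 0)" for i j
    using B(1) B(2)[OF eB, of i] eB[of i] eB[of j] e
    by (auto simp: bij_betw_def norm_eq_1 pairwise_def orthogonal_def inj_eq)
  moreover have "span (range e) = \<Gamma>"
    using e B(5) by (simp add: bij_betw_def)
  ultimately show ?thesis
    using that by blast
qed

text \<open>
  The mean-zero condition is a hyperplane in the \<open>m\<close>-dimensional space, so \<open>m - 1\<close> such vectors
  are available.
\<close>

lemma centred_orthonormal_vectors: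
  obtains g :: "nat \<Rightarrow> real^'m"
  where "\<And>k. k < CARD('m) - 1 \<Longrightarrow> (\<Sum>i\<in>UNIV. g k $ i) = 0"
    and "\<And>k l. k < CARD('m) - 1 \<Longrightarrow> l < CARD('m) - 1 \<Longrightarrow> g k \<bullet> g l = (if k = l then 1 else 0)"
proof -
  let ?W = "{x :: real^'m. 1 \<bullet> x = 0}"
  have "(1 :: real^'m) \<noteq> 0"
    by simp
  then have dim: "dim ?W = CARD('m) - 1"
    using dim_hyperplane[of "1 :: real^'m"] by simp
  obtain B where B: "B \<subseteq> ?W" "pairwise orthogonal B" "\<And>x. x \<in> B \<Longrightarrow> norm x = 1"
    "independent B" "card B = dim ?W"
    using orthonormal_basis_subspace[OF subspace_hyperplane[of "1 :: real^'m"]] by metis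
  obtain g where g: "bij_betw g {0..<CARD('m) - 1} B"
    using ex_bij_betw_nat_finite[of B] B dim independent_imp_finite by metis
  have gB: "g k \<in> B" if "k < CARD('m) - 1" for k
    using g that by (auto simp: bij_betw_def)
  show ?thesis
  proof
    fix k assume k: "k < CARD('m) - 1"
    then show "(\<Sum>i\<in>UNIV. g k $ i) = 0"
      using gB[OF k] B(1) by (auto simp: inner_vec_def)
    fix l assume l: "l < CARD('m) - 1"
    show "g k \<bullet> g l = (if k = l then 1 else 0)"
      using gB[OF k] gB[OF l] k l B(2) B(3)[OF gB[OF k]] g
      by (auto simp: bij_betw_def norm_eq_1 pairwise_def orthogonal_def inj_on_eq_iff)
  qed
qed

text \<open>
  Take \<open>y k = (\<Sum>a. c a k *\<^sub>R e a)\<close>, where the coordinate vectors \<open>c a\<close> are centred, mutually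
  orthogonal and of length \<open>idx a\<close>. Then the compressed covariance is diagonal with the
  distinct entries \<open>(idx a)\<^sup>2 / m\<close>.
\<close>

lemma cyclic_tuple_exists:
  fixes e :: "'d::finite \<Rightarrow> real^'n"
  assumes e: "\<And>i j. e i \<bullet> e j = (if i = j then 1 else 0)"
    and idx: "bij_betw idx UNIV {..<CARD('d)}" and dm: "CARD('d) \<le> CARD('m::finite)"
  shows "\<exists>y\<in>(mean_centred_tuples :: (real^'n^'m) set).
           det (krylov_matrix idx (compression e (tuple_covariance y)) 1) \<noteq> 0"
proof -
  obtain g :: "nat \<Rightarrow> real^'m" where g: "\<And>k. k < CARD('m) - 1 \<Longrightarrow> (\<Sum>i\<in>UNIV. g k $ i) = 0"
    "\<And>k l. k < CARD('m) - 1 \<Longrightarrow> l < CARD('m) - 1 \<Longrightarrow> g k \<bullet> g l = (if k = l then 1 else 0)"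
    using centred_orthonormal_vectors by metis
  \<comment> \<open>For \<open>idx a = 0\<close> the truncated index is harmless, since the factor is zero; this leaves only
     \<open>d - 1 \<le> m - 1\<close> vectors to be chosen.\<close>
  define c where "c a = real (idx a) *\<^sub>R g (idx a - 1)" for a
  define y :: "real^'n^'m" where "y = (\<chi> k. \<Sum>a\<in>UNIV. c a $ k *\<^sub>R e a)"
  have bound: "idx a - 1 < CARD('m) - 1" if "idx a \<noteq> 0" for a
  proof -
    have "idx a < CARD('d)"
      using idx by (auto simp: bij_betw_def)
    then show ?thesis
      using that dm by simp
  qed
  have sum_c: "(\<Sum>k\<in>UNIV. c a $ k) = 0" for a
    using g(1)[OF bound, of a] by (cases "idx a = 0") (auto simp: c_def sum_distrib_left[symmetric])
  have inj: "inj idx"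
    using idx by (simp add: bij_betw_def)
  have inner_c: "c a \<bullet> c b = (if a = b then (real (idx a))^2 else 0)" for a b
  proof (cases "idx a = 0 \<or> idx b = 0")
    case False
    then have "idx a - 1 = idx b - 1 \<longleftrightarrow> a = b"
      using inj by (metis Suc_pred' inj_eq neq0_conv)
    then show ?thesis
      using False g(2)[OF bound bound, of a b] by (simp add: c_def power2_eq_square)
  qed (auto simp: c_def)
  have "(\<Sum>k\<in>UNIV. y $ k) = (\<Sum>a\<in>UNIV. (\<Sum>k\<in>UNIV. c a $ k) *\<^sub>R e a)"
    by (simp add: y_def scaleR_sum_left) (rule sum.swap)
  then have "y \<in> mean_centred_tuples"
    by (simp add: mean_centred_tuples_def sum_c)
  moreover have "det (krylov_matrix idx (compression e (tuple_covariance y)) 1) \<noteq> 0"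
  proof (rule cyclic_if_diagonal_distinct[OF idx])
    have "y $ k \<bullet> e a = c a $ k" for k a
      by (simp add: y_def inner_sum_left e if_distrib cong: if_cong)
    then show "compression e (tuple_covariance y) $ a $ b
        = (if a = b then (real (idx a))^2 / real CARD('m) else 0)" for a b
      using inner_c[of a b] by (simp add: compression_def inner_tuple_covariance inner_vec_def[of "c a"])
    show "inj (\<lambda>a. (real (idx a))^2 / real CARD('m))"
      using inj by (auto simp: inj_def power2_eq_iff_nonneg)
  qed
  ultimately show ?thesis
    by blast
qed

lemma generic_simple_ritz_values:
  fixes \<Gamma> :: "(real^'n) set"
  assumes \<Gamma>: "subspace \<Gamma>" and "CARD('n) \<le> CARD('m::finite)" "CARD('d::finite) = dim \<Gamma>"
  shows "\<exists>U :: (real^'n^'m) set. zariski_open_in mean_centred_tuples U \<and> U \<noteq> {} \<and>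
           (\<forall>y\<in>U. simple_ritz_values \<Gamma> (tuple_covariance y))"
proof -
  obtain e :: "'d \<Rightarrow> real^'n" where e: "\<And>i j. e i \<bullet> e j = (if i = j then 1 else 0)"
      "span (range e) = \<Gamma>"
    using orthonormal_family[OF \<Gamma> assms(3)] by metis
  obtain idx :: "'d \<Rightarrow> nat" where idx: "bij_betw idx UNIV {..<CARD('d)}"
    using ex_bij_betw_finite_nat[of "UNIV :: 'd set"] by (auto simp: atLeast0LessThan)
  have "CARD('d) \<le> CARD('m)"
    using assms dim_subset_UNIV[of \<Gamma>] by simp
  define P where
    "P = range (\<lambda>v (y :: real^'n^'m). det (krylov_matrix idx (compression e (tuple_covariance y)) v))"
  define U where "U = {y \<in> mean_centred_tuples. \<exists>p\<in>P. p y \<noteq> 0}"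
  have "real_polynomial_function p" if "p \<in> P" for p
    using that real_polynomial_function_krylov[OF real_polynomial_function_compression]
    by (auto simp: P_def)
  then have "zariski_open_in mean_centred_tuples U"
    unfolding zariski_open_in_def U_def by blast
  moreover have "U \<noteq> {}"
    using cyclic_tuple_exists[OF e(1) idx \<open>CARD('d) \<le> CARD('m)\<close>] by (auto simp: U_def P_def)
  moreover have "simple_ritz_values \<Gamma> (tuple_covariance y)" if "y \<in> U" for y
    using that simple_ritz_values_if_cyclic[OF transpose_tuple_covariance \<Gamma> e]
    by (auto simp: U_def P_def)
  ultimately show ?thesis
    by blast
qed

section \<open>Sections of a quiver representation\<close>

lemma tot_of_vec_add: "tot_of_vec vtx b (x + y) v = tot_of_vec vtx b x v + tot_of_vec vtx b y v"
  by (simp add: tot_of_vec_def scaleR_add_left sum.distrib)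

lemma tot_of_vec_scaleR: "tot_of_vec vtx b (c *\<^sub>R x) v = c *\<^sub>R tot_of_vec vtx b x v"
  by (simp add: tot_of_vec_def scaleR_sum_right)

lemma subspace_section_space:
  assumes "quiver_rep Q A M"
  shows "subspace (section_space Q A M vtx b)"
proof -
  interpret quiver_rep Q A M
    by fact
  have add: "x + y \<in> section_space Q A M vtx b"
    if "x \<in> section_space Q A M vtx b" "y \<in> section_space Q A M vtx b" for x y
    using that
    by (auto simp: section_space_def sections_def Tot_def tot_of_vec_add edge_add
        intro!: subspace_add subspace_vertex)
  have scale: "c *\<^sub>R x \<in> section_space Q A M vtx b" if "x \<in> section_space Q A M vtx b" for c x
    using that
    by (auto simp: section_space_def sections_def Tot_def tot_of_vec_scaleR edge_scale
        intro!: subspace_scale subspace_vertex)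
  have "M e 0 = 0" if "e \<in> arcs Q" for e
    using edge_scale[OF that, of 0 0] subspace_0[OF subspace_vertex] that by auto
  then have "0 \<in> section_space Q A M vtx b"
    by (auto simp: section_space_def sections_def Tot_def tot_of_vec_def
        intro!: subspace_0 subspace_vertex)
  with add scale show ?thesis
    by (simp add: subspace_def)
qed

theorem mainTheorem2:
  fixes Q :: "('v, 'e) pre_digraph"
    and A :: "'v \<Rightarrow> 'a::real_vector set"
    and M :: "'e \<Rightarrow> 'a \<Rightarrow> 'a"
    and vtx :: "'n::finite \<Rightarrow> 'v"
    and b :: "'n \<Rightarrow> 'a"
  assumes "quiver_rep Q A M"
    and "tot_basis Q A vtx b"
    and "CARD('d::finite) = dim (section_space Q A M vtx b)"
    and "CARD('m::finite) \<ge> CARD('n)"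
  shows "\<exists>U :: (real^'n^'m) set.
    zariski_open_in mean_centred_tuples U \<and> U \<noteq> {} \<and>
    (\<forall>y\<in>U. \<forall>D. \<forall>F :: real^'d^'n.
       D = range (\<lambda>i. y $ i) \<and> card D = CARD('m) \<and>
       rank F = CARD('d) \<and> range ((*v) F) = section_space Q A M vtx b \<longrightarrow>
       (let S = sample_covariance D;
            G = transpose F ** S ** F;
            H = transpose F ** F
        in \<forall>r\<in>{1..CARD('d)}.
             (\<exists>l. is_nth_largest r (gen_eigenvalues G H) l \<and> (\<exists>u. gen_eigenvector G H l u)) \<and>
             (\<forall>l u. is_nth_largest r (gen_eigenvalues G H) l \<and> gen_eigenvector G H l u \<longrightarrow>
                (\<forall>L. is_principal_component (section_space Q A M vtx b) D r L
                       \<longleftrightarrow> L = span {F *v u}))))"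
proof -
  let ?\<Gamma> = "section_space Q A M vtx b"
  have \<Gamma>: "subspace ?\<Gamma>"
    using assms(1) by (rule subspace_section_space)
  obtain U :: "(real^'n^'m) set" where U: "zariski_open_in mean_centred_tuples U" "U \<noteq> {}"
    "\<And>y. y \<in> U \<Longrightarrow> simple_ritz_values ?\<Gamma> (tuple_covariance y)"
    using generic_simple_ritz_values[where 'd = 'd, OF \<Gamma> assms(4,3)] by blast
  show ?thesis
    unfolding Let_def
  proof (intro exI[of _ U] conjI U(1,2) ballI allI impI; elim conjE)
    fix y D and F :: "real^'d^'n" and r
    assume y: "y \<in> U" and D: "D = range (\<lambda>i. y $ i)" "card D = CARD('m)"
      and F: "rank F = CARD('d)" "range ((*v) F) = ?\<Gamma>" and r: "r \<in> {1..CARD('d)}"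
    have S: "sample_covariance D = tuple_covariance y"
      using sample_covariance_range D by blast
    have inj: "inj ((*v) F)"
      using F(1) full_rank_injective by blast
    note ritz = gen_eigenvalues_eq_ritz_values[OF inj F(2)] gen_eigenvector_iff_ritz_vector[OF inj F(2)]
    have pre: "transpose (sample_covariance D) = sample_covariance D"
      "simple_ritz_values ?\<Gamma> (sample_covariance D)" "r \<in> {1..dim ?\<Gamma>}"
      using S U(3)[OF y] r assms(3) transpose_tuple_covariance by auto
    note pc = principal_component_iff_ritz[OF pre(1) \<Gamma> pre(2,3)]
    show "\<exists>l. is_nth_largest r
          (gen_eigenvalues (transpose F ** sample_covariance D ** F) (transpose F ** F)) l \<and>
        (\<exists>u. gen_eigenvector (transpose F ** sample_covariance D ** F) (transpose F ** F) l u)"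
      using pc(1) unfolding ritz(1)[symmetric]
      by (meson gen_eigenvalue_iff_gen_eigenvector is_nth_largest_def)
    fix l u L
    assume "is_nth_largest r
          (gen_eigenvalues (transpose F ** sample_covariance D ** F) (transpose F ** F)) l"
      "gen_eigenvector (transpose F ** sample_covariance D ** F) (transpose F ** F) l u"
    then show "is_principal_component ?\<Gamma> D r L \<longleftrightarrow> L = span {F *v u}"
      using pc(2) unfolding ritz by blast
  qed
qed

end
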